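(* Let $S$ be an abelian semigroup (with the identical involution $s^*=s$) and let $\psi:S\to\mathbb{R}$ be a strictly positive function. Define $f:S\times\mathbb{Z}_+\to\mathbb{R}$ by $$f(s,m)=\frac{1}{\psi(s)+m},\qquad s\in S,\ m\in\mathbb{Z}_+.$$ Then $f$ is completely monotone on the product semigroup $S\times\mathbb{Z}_+$ (with the identical involution) if and only if $\psi$ is completely alternating on $S$.
   Context: $\mathbb{Z}_+$ is the set of non-negative integers, an abelian semigroup under addition; $S\times\mathbb{Z}_+$ carries the componentwise operation. For an abelian semigroup $T$ (written additively) and $a\in T$, the shift operator $E_a$ acts on functions $g:T\to\mathbb{R}$ by $(E_ag)(s)=g(s+a)$, and $\nabla_a:=I-E_a$, i.e. $(\nabla_a g)(s)=g(s)-g(s+a)$. A function $\phi:T\to\mathbb{R}$ is completely monotone if $\phi\geq 0$ and for all $n\geq 1$, all $a_1,\dots,a_n\in T$ (repetitions allowed) and all $s\in T$, $\nabla_{a_1}\cdots\nabla_{a_n}\phi(s)\geq 0$. A function $\psi:T\to\mathbb{R}$ is completely alternating if for all $n\geq 1$, all $a_1,\dots,a_n\in T$ (repetitions allowed) and all $s\in T$, $\nabla_{a_1}\cdots\nabla_{a_n}\psi(s)\leq 0$. *)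

theory Defs
  imports Complex_Main "HOL-Library.Product_Plus"
begin

text \<open>An abelian semigroup is a type of class \<^class>\<open>ab_semigroup_add\<close>; no neutral element is
  required. The product of two such types carries the componentwise addition.
  The involution is the identity throughout and so does not appear in the definitions.\<close>

definition shift :: "'a::ab_semigroup_add \<Rightarrow> ('a \<Rightarrow> real) \<Rightarrow> 'a \<Rightarrow> real" where
  "shift a g = (\<lambda>s. g (s + a))"

definition nabla :: "'a::ab_semigroup_add \<Rightarrow> ('a \<Rightarrow> real) \<Rightarrow> 'a \<Rightarrow> real" where
  "nabla a g = (\<lambda>s. g s - shift a g s)"

text \<open>In the next two definitions a nonempty list \<open>[a\<^sub>1, \<dots>, a\<^sub>n]\<close> stands for the choice of
  \<open>n \<ge> 1\<close> and of the (possibly repeated) shifts; \<open>foldr nabla [a\<^sub>1, \<dots>, a\<^sub>n] g\<close> is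
  \<open>nabla a\<^sub>1 (\<dots> (nabla a\<^sub>n g))\<close>.\<close>

definition completely_monotone :: "('a::ab_semigroup_add \<Rightarrow> real) \<Rightarrow> bool" where
  "completely_monotone \<phi> \<longleftrightarrow>
     (\<forall>s. \<phi> s \<ge> 0) \<and> (\<forall>as. as \<noteq> [] \<longrightarrow> (\<forall>s. foldr nabla as \<phi> s \<ge> 0))"

definition completely_alternating :: "('a::ab_semigroup_add \<Rightarrow> real) \<Rightarrow> bool" where
  "completely_alternating \<psi> \<longleftrightarrow> (\<forall>as. as \<noteq> [] \<longrightarrow> (\<forall>s. foldr nabla as \<psi> s \<le> 0))"

end

theory Submission
  imports Defs
begin

text \<open>If \<open>\<Psi> > 0\<close> is completely alternating and \<open>g = 1 / \<Psi>\<close>, then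
  \<open>nabla a g = (- nabla a \<Psi>) * g * shift a g\<close>, where the first factor is completely monotone.
  Since products preserve nonnegativity of all differences up to a given order, this property
  passes from order \<open>n\<close> to order \<open>n + 1\<close> for \<open>g\<close>. It is applied to \<open>\<Psi> (s, m) = \<psi> s + m\<close>.
  Conversely, \<open>m - m\<^sup>2 * f (s, m) = m * \<psi> s / (\<psi> s + m)\<close> tends to \<open>\<psi> s\<close> as \<open>m\<close> grows, and on
  the left the constant \<open>m\<close> is annihilated by every difference.\<close>

lemma foldr_nabla_const:
  "foldr nabla as (\<lambda>_. c) = (\<lambda>_. if as = [] then c else 0)"
  by (induction as) (auto simp: nabla_def shift_def)

lemma foldr_nabla_add:
  "foldr nabla as (\<lambda>s. g s + h s) = (\<lambda>s. foldr nabla as g s + foldr nabla as h s)"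
  by (induction as) (auto simp: nabla_def shift_def)

lemma foldr_nabla_cmult:
  "foldr nabla as (\<lambda>s. c * g s) = (\<lambda>s. c * foldr nabla as g s)"
  by (induction as) (auto simp: nabla_def shift_def algebra_simps)

lemma foldr_nabla_uminus:
  "foldr nabla as (\<lambda>s. - g s) = (\<lambda>s. - foldr nabla as g s)"
  using foldr_nabla_cmult[of as "-1" g] by simp

lemma foldr_nabla_shift:
  "foldr nabla as (shift a g) = shift a (foldr nabla as g)"
  by (induction as) (auto simp: nabla_def shift_def fun_eq_iff add_ac)

lemma foldr_nabla_fst:
  "foldr nabla as (\<lambda>p. g (fst p)) = (\<lambda>p. foldr nabla (map fst as) g (fst p))"
  by (induction as) (auto simp: nabla_def shift_def)

lemma foldr_nabla_snd:
  "foldr nabla as (\<lambda>p. g (snd p)) = (\<lambda>p. foldr nabla (map snd as) g (snd p))"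
  by (induction as) (auto simp: nabla_def shift_def)

text \<open>A shift by \<open>(a, 0)\<close> leaves the second coordinate fixed, so monotonicity on
  the product restricts to each slice with \<open>m\<close> frozen.\<close>

lemma foldr_nabla_slice:
  fixes f :: "'a::ab_semigroup_add \<times> 'b::comm_monoid_add \<Rightarrow> real"
  shows "foldr nabla (map (\<lambda>a. (a, 0)) as) f (s, m) = foldr nabla as (\<lambda>s. f (s, m)) s"
  by (induction as arbitrary: s) (auto simp: nabla_def shift_def)

text \<open>An iterated difference at \<open>s\<close> is a finite signed sum of values, so
  pointwise convergence suffices.\<close>

lemma tendsto_foldr_nabla:
  assumes "\<And>s. ((\<lambda>x. g x s) \<longlongrightarrow> h s) F"
  shows "((\<lambda>x. foldr nabla as (g x) s) \<longlongrightarrow> foldr nabla as h s) F"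
  by (induction as arbitrary: s) (auto simp: nabla_def shift_def intro!: assms tendsto_diff)

definition monotone_upto :: "nat \<Rightarrow> ('a::ab_semigroup_add \<Rightarrow> real) \<Rightarrow> bool" where
  "monotone_upto n g \<longleftrightarrow> (\<forall>as. length as \<le> n \<longrightarrow> (\<forall>s. foldr nabla as g s \<ge> 0))"

lemma completely_monotone_iff_monotone_upto:
  "completely_monotone g \<longleftrightarrow> (\<forall>n. monotone_upto n g)"
proof -
  have "(\<forall>s. g s \<ge> 0) \<longleftrightarrow> (\<forall>s. foldr nabla [] g s \<ge> 0)"
    by simp
  then show ?thesis
    unfolding completely_monotone_def monotone_upto_def by (metis order_refl)
qed

lemma monotone_upto_0: "monotone_upto 0 g \<longleftrightarrow> (\<forall>s. g s \<ge> 0)"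
  by (simp add: monotone_upto_def)

text \<open>The last list entry is the innermost operator:
  \<open>foldr nabla (as @ [a]) g = foldr nabla as (nabla a g)\<close>. Peeling it off lowers the
  order by one at the cost of changing the function.\<close>

lemma monotone_upto_Suc:
  "monotone_upto (Suc n) g \<longleftrightarrow> (\<forall>s. g s \<ge> 0) \<and> (\<forall>a. monotone_upto n (nabla a g))"
proof (intro iffI conjI allI)
  assume g: "monotone_upto (Suc n) g"
  show "g s \<ge> 0" for s
    using g[unfolded monotone_upto_def, rule_format, of "[]" s] by simp
  show "monotone_upto n (nabla a g)" for a
    unfolding monotone_upto_def
    using g[unfolded monotone_upto_def, rule_format, of "_ @ [a]"] by simp
next
  assume g: "(\<forall>s. g s \<ge> 0) \<and> (\<forall>a. monotone_upto n (nabla a g))"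
  show "monotone_upto (Suc n) g"
    unfolding monotone_upto_def
  proof (intro allI impI)
    fix as :: "'a list" and s
    assume "length as \<le> Suc n"
    then show "foldr nabla as g s \<ge> 0"
      using g by (cases as rule: rev_cases) (auto simp: monotone_upto_def)
  qed
qed

lemma monotone_upto_SucD: "monotone_upto (Suc n) g \<Longrightarrow> monotone_upto n g"
  by (simp add: monotone_upto_def)

lemma monotone_upto_add:
  "monotone_upto n g \<Longrightarrow> monotone_upto n h \<Longrightarrow> monotone_upto n (\<lambda>s. g s + h s)"
  by (simp add: monotone_upto_def foldr_nabla_add)

lemma monotone_upto_shift: "monotone_upto n g \<Longrightarrow> monotone_upto n (shift a g)"
  by (simp add: monotone_upto_def foldr_nabla_shift) (simp add: shift_def)

lemma nabla_mult:
  "nabla a (\<lambda>s. g s * h s) = (\<lambda>s. nabla a g s * h s + shift a g s * nabla a h s)"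
  by (auto simp: nabla_def shift_def algebra_simps)

text \<open>By the product rule \<open>nabla_mult\<close>, a first difference of a product is a sum
  of two products whose factors are all monotone up to order \<open>n\<close>.\<close>

lemma monotone_upto_mult:
  "monotone_upto n g \<Longrightarrow> monotone_upto n h \<Longrightarrow> monotone_upto n (\<lambda>s. g s * h s)"
proof (induction n arbitrary: g h)
  case 0
  then show ?case by (simp add: monotone_upto_0)
next
  case (Suc n)
  have "monotone_upto n (nabla a (\<lambda>s. g s * h s))" for a
    unfolding nabla_mult
    by (intro monotone_upto_add Suc.IH monotone_upto_shift Suc.prems[THEN monotone_upto_SucD])
      (use Suc.prems in \<open>simp_all add: monotone_upto_Suc\<close>)
  with Suc.prems show ?case
    by (auto simp: monotone_upto_Suc)
qed

lemma completely_alternating_imp_completely_monotone_inverse: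
  assumes pos: "\<And>s. \<Psi> s > 0" and alt: "completely_alternating \<Psi>"
  shows "completely_monotone (\<lambda>s. 1 / \<Psi> s)"
  unfolding completely_monotone_iff_monotone_upto
proof
  fix n
  let ?g = "\<lambda>s. 1 / \<Psi> s"
  show "monotone_upto n ?g"
  proof (induction n)
    case 0
    show ?case using pos by (simp add: monotone_upto_0 less_imp_le)
  next
    case (Suc n)
    have "monotone_upto n (nabla a ?g)" for a
    proof -
      \<comment> \<open>Appending \<open>a\<close> keeps the list nonempty even for
        \<open>as = []\<close>, so this covers the values of \<open>nabla a \<Psi>\<close> as well
        as its differences.\<close>
      have "foldr nabla (as @ [a]) \<Psi> s \<le> 0" for as s
        using alt unfolding completely_alternating_def by blast
      then have "monotone_upto n (\<lambda>s. - nabla a \<Psi> s)"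
        by (simp add: monotone_upto_def foldr_nabla_uminus)
      then have "monotone_upto n (\<lambda>s. (- nabla a \<Psi> s * ?g s) * shift a ?g s)"
        by (intro monotone_upto_mult monotone_upto_shift Suc.IH)
      also have "(\<lambda>s. (- nabla a \<Psi> s * ?g s) * shift a ?g s) = nabla a ?g"
      proof
        fix s
        have "\<Psi> s \<noteq> 0" "\<Psi> (s + a) \<noteq> 0"
          using pos[of s] pos[of "s + a"] by auto
        then show "(- nabla a \<Psi> s * ?g s) * shift a ?g s = nabla a ?g s"
          by (simp add: nabla_def shift_def field_simps)
      qed
      finally show ?thesis .
    qed
    with pos show ?case
      by (simp add: monotone_upto_Suc less_imp_le)
  qed
qed

text \<open>The first difference is the constant \<open>- real k\<close>, and all further ones
  vanish.\<close>

lemma completely_alternating_of_nat: "completely_alternating (real :: nat \<Rightarrow> real)"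
  unfolding completely_alternating_def
proof (intro allI impI)
  fix as :: "nat list" and s
  assume "as \<noteq> []"
  then obtain bs k where "as = bs @ [k]"
    by (cases as rule: rev_cases) auto
  moreover have "nabla k real = (\<lambda>_. - real k)"
    by (auto simp: nabla_def shift_def)
  ultimately show "foldr nabla as real s \<le> 0"
    by (simp add: foldr_nabla_const)
qed

text \<open>Differences of a function of one coordinate use only the projected shifts, and
  projecting keeps the list nonempty.\<close>

lemma completely_alternating_prod_add:
  assumes "completely_alternating g" "completely_alternating h"
  shows "completely_alternating (\<lambda>p. g (fst p) + h (snd p))"
  using assms
  by (simp add: completely_alternating_def foldr_nabla_add foldr_nabla_fst foldr_nabla_snd
      add_nonpos_nonpos)

lemma tendsto_mult_divide_add_of_nat:
  fixes x :: real
  shows "(\<lambda>m. real m * (x / (x + real m))) \<longlonglongrightarrow> x"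
proof -
  have "(\<lambda>m. x / (x / real m + 1)) \<longlonglongrightarrow> x / (0 + 1)"
    by (intro tendsto_intros lim_const_over_n) auto
  \<comment> \<open>At \<open>m = 0\<close> division by zero makes the left side \<open>x\<close>
    and the right side 0, so equality is claimed only eventually.\<close>
  moreover have "\<forall>\<^sub>F m in sequentially. x / (x / real m + 1) = real m * (x / (x + real m))"
    using eventually_gt_at_top[of 0]
    by eventually_elim (simp add: field_simps)
  ultimately show ?thesis
    by (simp add: tendsto_cong)
qed

theorem theorem1p4:
  fixes \<psi> :: "'a::ab_semigroup_add \<Rightarrow> real"
    and f :: "'a \<times> nat \<Rightarrow> real"
  assumes psi_pos: "\<And>s. \<psi> s > 0"
    and f_def: "\<And>s m. f (s, m) = 1 / (\<psi> s + real m)"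
  shows "completely_monotone f \<longleftrightarrow> completely_alternating \<psi>"
proof
  assume mono: "completely_monotone f"
  show "completely_alternating \<psi>"
    unfolding completely_alternating_def
  proof (intro allI impI)
    fix as :: "'a list" and s
    assume "as \<noteq> []"
    let ?h = "\<lambda>m s. real m * (\<psi> s / (\<psi> s + real m))"
    have "foldr nabla as (?h m) s \<le> 0" for m
    proof -
      \<comment> \<open>Positivity of \<open>\<psi> s\<close> keeps the denominator nonzero, also at
        \<open>m = 0\<close>.\<close>
      have "?h m s = real m + - (real m)\<^sup>2 * f (s, m)" for s
        using psi_pos[of s] by (simp add: f_def field_simps power2_eq_square)
      then have "foldr nabla as (?h m) s = - (real m)\<^sup>2 * foldr nabla as (\<lambda>s. f (s, m)) s"
        using \<open>as \<noteq> []\<close> by (simp only: foldr_nabla_add foldr_nabla_cmult foldr_nabla_const) simp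
      moreover have "foldr nabla (map (\<lambda>a. (a, 0)) as) f (s, m) \<ge> 0"
        using mono \<open>as \<noteq> []\<close> unfolding completely_monotone_def by simp
      ultimately show ?thesis
        by (simp add: foldr_nabla_slice)
    qed
    moreover have "(\<lambda>m. foldr nabla as (?h m) s) \<longlonglongrightarrow> foldr nabla as \<psi> s"
      by (intro tendsto_foldr_nabla tendsto_mult_divide_add_of_nat)
    ultimately show "foldr nabla as \<psi> s \<le> 0"
      by (intro LIMSEQ_le_const2) auto
  qed
next
  assume "completely_alternating \<psi>"
  then have "completely_alternating (\<lambda>p. \<psi> (fst p) + real (snd p))"
    by (intro completely_alternating_prod_add completely_alternating_of_nat)
  then have "completely_monotone (\<lambda>p. 1 / (\<psi> (fst p) + real (snd p)))"
    by (intro completely_alternating_imp_completely_monotone_inverse) (simp add: psi_pos add_pos_nonneg)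
  moreover have "f = (\<lambda>p. 1 / (\<psi> (fst p) + real (snd p)))"
    using f_def by auto
  ultimately show "completely_monotone f"
    by simp
qed

end
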